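(* Let $A$ be a bounded linear operator on a complex Hilbert space $\mathbb{H}$ with scalar product $\langle\cdot,\cdot\rangle_{\mathbb{H}}$. Then $$\sigma_n(A)=\overline{W(A)},$$ where $W(A)=\{\langle Ax,x\rangle_{\mathbb{H}}:\ x\in\mathbb{H},\ \|x\|=1\}$ is the numerical range of $A$.
   Context: For $\theta\in[0,2\pi)$ and $\omega\in\mathbb{R}$ let $H_{\theta,\omega}:=\{e^{i\theta}\lambda:\ \lambda\in\mathbb{C},\ \mathrm{Re}\,\lambda>\omega\}$, an open half plane with boundary $\partial H_{\theta,\omega}$, and let $d(\lambda,\partial H_{\theta,\omega}):=\inf\{|\lambda-\mu|:\mu\in\partial H_{\theta,\omega}\}$. For a closed, densely defined operator $A$ with resolvent set $\rho(A)$ and resolvent $R(\lambda,A)=(\lambda-A)^{-1}$, the numerical resolvent set $\rho_n(A)$ is the union of all open half planes $H_{\theta,\omega}$ (with $\theta\in[0,2\pi)$, $\omega\in\mathbb{R}$) such that $H_{\theta,\omega}\subseteq\rho(A)$ and $\|R(\lambda,A)\|\le \frac{1}{d(\lambda,\partial H_{\theta,\omega})}$ for all $\lambda\in H_{\theta,\omega}$. The numerical spectrum is $\sigma_n(A):=\mathbb{C}\setminus\rho_n(A)$. *)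

theory Defs
  imports "HOL-Analysis.Analysis"
begin

class scaleC =
  fixes scaleC :: "complex \<Rightarrow> 'a \<Rightarrow> 'a" (infixr \<open>*\<^sub>C\<close> 75)

class complex_vector = real_vector + scaleC +
  assumes scaleC_add_right: "a *\<^sub>C (x + y) = a *\<^sub>C x + a *\<^sub>C y"
    and scaleC_add_left: "(a + b) *\<^sub>C x = a *\<^sub>C x + b *\<^sub>C x"
    and scaleC_scaleC: "a *\<^sub>C b *\<^sub>C x = (a * b) *\<^sub>C x"
    and scaleC_of_real: "complex_of_real r *\<^sub>C x = r *\<^sub>R x"

class complex_normed_vector = complex_vector + real_normed_vector +
  assumes norm_scaleC: "norm (a *\<^sub>C x) = cmod a * norm x"

text \<open>The scalar product is linear in the first and conjugate-linear in the second argument.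
  The opposite convention would replace the numerical range by its complex conjugate.\<close>

class complex_inner = complex_normed_vector +
  fixes cinner :: "'a \<Rightarrow> 'a \<Rightarrow> complex"
  assumes cinner_add_left: "cinner (x + y) z = cinner x z + cinner y z"
    and cinner_scaleC_left: "cinner (a *\<^sub>C x) y = a * cinner x y"
    and cinner_commute: "cinner x y = cnj (cinner y x)"
    and cinner_self_eq_norm: "cinner x x = complex_of_real ((norm x)\<^sup>2)"

class complex_hilbert_space = complex_inner + complete_space

instantiation complex :: complex_hilbert_space
begin

definition scaleC_complex :: "complex \<Rightarrow> complex \<Rightarrow> complex"
  where "scaleC_complex a x = a * x"

definition cinner_complex :: "complex \<Rightarrow> complex \<Rightarrow> complex"
  where "cinner_complex x y = x * cnj y"

instance
  by standard
    (simp_all add: scaleC_complex_def cinner_complex_def algebra_simps scaleR_conv_of_real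
      norm_mult complex_norm_square[symmetric])

end

definition bounded_clinear ::
    "('a::complex_normed_vector \<Rightarrow> 'b::complex_normed_vector) \<Rightarrow> bool"
  where "bounded_clinear f \<longleftrightarrow> bounded_linear f \<and> (\<forall>c x. f (c *\<^sub>C x) = c *\<^sub>C f x)"

text \<open>A possibly unbounded operator is given by its domain \<open>D\<close> and a function \<open>A\<close> of which
  only the values on \<open>D\<close> matter. The notions below are meant for closed, densely defined
  operators; an everywhere defined bounded operator has domain \<open>UNIV\<close>.\<close>

definition resolvent :: "'a::complex_normed_vector set \<Rightarrow> ('a \<Rightarrow> 'a) \<Rightarrow> complex \<Rightarrow> 'a \<Rightarrow> 'a"
  where "resolvent D A l = inv_into D (\<lambda>x. l *\<^sub>C x - A x)"

definition resolvent_set :: "'a::complex_normed_vector set \<Rightarrow> ('a \<Rightarrow> 'a) \<Rightarrow> complex set"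
  where "resolvent_set D A =
    {l. bij_betw (\<lambda>x. l *\<^sub>C x - A x) D UNIV \<and> bounded_clinear (resolvent D A l)}"

definition half_plane :: "real \<Rightarrow> real \<Rightarrow> complex set"
  where "half_plane \<theta> \<omega> = {exp (\<i> * complex_of_real \<theta>) * l | l. Re l > \<omega>}"

definition numerical_resolvent_set ::
    "'a::complex_normed_vector set \<Rightarrow> ('a \<Rightarrow> 'a) \<Rightarrow> complex set"
  where "numerical_resolvent_set D A =
    \<Union> {half_plane \<theta> \<omega> | \<theta> \<omega>. \<theta> \<in> {0..<2 * pi} \<and>
        half_plane \<theta> \<omega> \<subseteq> resolvent_set D A \<and>
        (\<forall>l\<in>half_plane \<theta> \<omega>.
           onorm (resolvent D A l) \<le> 1 / infdist l (frontier (half_plane \<theta> \<omega>)))}"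

definition numerical_spectrum :: "'a::complex_normed_vector set \<Rightarrow> ('a \<Rightarrow> 'a) \<Rightarrow> complex set"
  where "numerical_spectrum D A = - numerical_resolvent_set D A"

definition numerical_range :: "('a::complex_inner \<Rightarrow> 'a) \<Rightarrow> complex set"
  where "numerical_range A = {cinner (A x) x | x. norm x = 1}"

end

theory Submission
  imports Defs
begin

text \<open>
  The half planes that occur in the numerical resolvent set of a bounded operator \<open>A\<close> are exactly
  the open half planes that do not meet its numerical range \<open>W\<close>; the theorem follows because
  the closure of \<open>W\<close> is convex, so that its complement is the union of the open half planes
  that avoid it.

  Write a half plane as \<open>Re (cnj u * z) > \<omega>\<close> with \<open>u = cis \<theta>\<close>. A point \<open>l\<close> in it has
  distance \<open>Re (cnj u * l) - \<omega>\<close> from the boundary. If the half plane avoids \<open>W\<close>, then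
  \<open>cnj u *\<^sub>C (l - A)\<close> is coercive with exactly this distance as its constant, and a
  coercive operator on a Hilbert space is invertible with inverse bounded by the reciprocal of the
  constant (lemmas \<open>coercive_surj\<close> and \<open>resolvent_coercive\<close>). Conversely, the resolvent
  estimate along the ray \<open>l = (\<omega> + t) u\<close> says \<open>t \<le> norm (v - t u x)\<close> for unit vectors
  \<open>x\<close>, where \<open>v = A x - \<omega> u x\<close>; expanding the square and letting \<open>t\<close> grow gives
  \<open>Re (cnj u * cinner (A x) x) \<le> \<omega>\<close> (lemma \<open>numerical_range_disjoint_half_plane\<close>).

  The convexity of \<open>W\<close> is the Toeplitz-Hausdorff theorem, proved here by the intermediate
  value theorem on the plane spanned by two unit vectors.
\<close>

section \<open>Scalar product identities\<close>

lemma scaleC_one: "1 *\<^sub>C x = (x::'a::complex_vector)"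
  using scaleC_of_real[of 1 x] by simp

lemma scaleC_minus_one: "(-1) *\<^sub>C x = - (x::'a::complex_vector)"
  using scaleC_of_real[of "-1" x] by simp

lemma scaleC_zero_right: "c *\<^sub>C (0::'a::complex_vector) = 0"
  using scaleC_add_right[of c "0::'a" 0] by simp

lemma scaleC_zero_left: "0 *\<^sub>C x = (0::'a::complex_vector)"
  using scaleC_of_real[of 0 x] by simp

lemma scaleC_minus_right: "c *\<^sub>C (- x) = - (c *\<^sub>C (x::'a::complex_vector))"
  using scaleC_add_right[of c x "- x"] by (simp add: scaleC_zero_right eq_neg_iff_add_eq_0 add.commute)

lemma scaleC_diff_right: "c *\<^sub>C (x - y) = c *\<^sub>C x - c *\<^sub>C (y::'a::complex_vector)"
  using scaleC_add_right[of c x "- y"] by (simp add: scaleC_minus_right)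

lemma scaleC_diff_left: "(c - d) *\<^sub>C x = c *\<^sub>C x - d *\<^sub>C (x::'a::complex_vector)"
  using scaleC_add_left[of "c - d" d x] by simp

lemma scaleC_scaleR: "c *\<^sub>C (r *\<^sub>R x) = r *\<^sub>R (c *\<^sub>C (x::'a::complex_vector))"
  by (metis scaleC_of_real scaleC_scaleC mult.commute)

lemma cinner_zero_left: "cinner 0 (z::'a::complex_inner) = 0"
  using cinner_add_left[of 0 0 z] by simp

lemma cinner_diff_left: "cinner (x - y) z = cinner x z - cinner y (z::'a::complex_inner)"
  using cinner_add_left[of "x - y" y z] by simp

lemma cinner_add_right: "cinner z (x + y) = cinner z x + cinner z (y::'a::complex_inner)"
  by (metis cinner_add_left cinner_commute complex_cnj_add)

lemma cinner_scaleC_right: "cinner y (c *\<^sub>C x) = cnj c * cinner y (x::'a::complex_inner)"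
  by (metis cinner_scaleC_left cinner_commute complex_cnj_mult)

lemma norm_add_square:
  "(norm (x + y))\<^sup>2 = (norm x)\<^sup>2 + 2 * Re (cinner x y) + (norm (y::'a::complex_inner))\<^sup>2"
proof -
  have "complex_of_real ((norm (x + y))\<^sup>2) = cinner (x + y) (x + y)"
    by (simp add: cinner_self_eq_norm)
  also have "\<dots> = complex_of_real ((norm x)\<^sup>2) + (cinner x y + cnj (cinner x y))
      + complex_of_real ((norm y)\<^sup>2)"
    by (simp add: cinner_add_left cinner_add_right cinner_commute[of y x]
        cinner_self_eq_norm[symmetric] del: of_real_power)
  also have "\<dots> = complex_of_real ((norm x)\<^sup>2 + 2 * Re (cinner x y) + (norm y)\<^sup>2)"
    by (simp add: complex_add_cnj)
  finally show ?thesis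
    by (simp only: of_real_eq_iff)
qed

lemma norm_diff_square:
  "(norm (x - y))\<^sup>2 = (norm x)\<^sup>2 - 2 * Re (cinner x y) + (norm (y::'a::complex_inner))\<^sup>2"
  using norm_add_square[of "x - y" y] cinner_self_eq_norm[of y]
  by (simp add: cinner_diff_left)

text \<open>The real part of the Cauchy-Schwarz inequality is the triangle inequality, squared.\<close>

lemma Re_cinner_le_norm: "Re (cinner x y) \<le> norm x * norm (y::'a::complex_inner)"
proof -
  have "(norm (x + y))\<^sup>2 \<le> (norm x + norm y)\<^sup>2"
    by (intro power_mono norm_triangle_ineq) simp
  then show ?thesis
    by (simp add: norm_add_square power2_sum)
qed

section \<open>Convexity of the numerical range\<close>

text \<open>Rotating \<open>x\<close> by a suitable phase makes the sum of the two cross terms of the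
  quadratic form real. The form is then real along the segment from the rotated vector to \<open>y\<close>,
  and its quotient by the squared norm goes continuously from \<open>0\<close> to \<open>1\<close>.\<close>

lemma toeplitz_hausdorff_normalized:
  fixes B :: "'a::complex_inner \<Rightarrow> 'a"
  assumes add: "\<And>x y. B (x + y) = B x + B y"
    and scale: "\<And>c x. B (c *\<^sub>C x) = c *\<^sub>C B x"
    and x: "norm x = 1" "cinner (B x) x = 0"
    and y: "norm y = 1" "cinner (B y) y = 1"
    and t: "0 \<le> t" "t \<le> 1"
  shows "\<exists>z. norm z = 1 \<and> cinner (B z) z = complex_of_real t"
proof -
  \<comment> \<open>The cross terms after rotation by \<open>c\<close> have imaginary part \<open>Im (c * w)\<close>.\<close>
  define w where "w = cinner (B x) y - cnj (cinner (B y) x)"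
  define c where "c = (if w = 0 then 1 else cnj w / complex_of_real (cmod w))"
  have c1: "cmod c = 1"
    by (simp add: c_def norm_divide)
  have "c * w = complex_of_real (cmod w)"
    by (auto simp: c_def field_simps complex_norm_square[symmetric] power2_eq_square)
  then have Im_cw: "Im (c * w) = 0"
    by simp
  define u where "u = c *\<^sub>C x"
  have u: "norm u = 1" "cinner (B u) u = 0"
    by (simp_all add: u_def norm_scaleC c1 x scale cinner_scaleC_left cinner_scaleC_right)
  define g where "g = cinner (B u) y + cinner (B y) u"
  have "Im g = 0"
    using Im_cw
    by (simp add: g_def u_def w_def scale cinner_scaleC_left cinner_scaleC_right algebra_simps)
  then have g: "g = complex_of_real (Re g)"
    by (simp add: complex_eq_iff)
  define z where "z s = complex_of_real (1 - s) *\<^sub>C u + complex_of_real s *\<^sub>C y" for s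
  have q: "cinner (B (z s)) (z s) = complex_of_real (s * (1 - s) * Re g + s\<^sup>2)" for s
  proof -
    have "cinner (B (z s)) (z s) = complex_of_real s * complex_of_real (1 - s) * g
        + (complex_of_real s)\<^sup>2"
      using u(2) y(2)
      by (simp add: z_def add scale cinner_add_left cinner_add_right cinner_scaleC_left
          cinner_scaleC_right g_def power2_eq_square algebra_simps)
    then show ?thesis
      by (subst (asm) g) simp
  qed
  \<comment> \<open>Multiplying out the norm lets the intermediate value theorem apply before \<open>z s\<close> is
      known to be nonzero.\<close>
  define h where "h s = s * (1 - s) * Re g + s\<^sup>2 - t * (norm (z s))\<^sup>2" for s
  have "continuous_on {0..1} h"
    unfolding h_def z_def scaleC_of_real by (intro continuous_intros)
  moreover have "h 0 \<le> 0" "0 \<le> h 1"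
    using t u y by (simp_all add: h_def z_def scaleC_one scaleC_zero_left)
  ultimately obtain s where s: "0 \<le> s" "s \<le> 1" "h s = 0"
    using IVT'[of h 0 0 1] by auto
  \<comment> \<open>The form separates the two vectors: it vanishes on the multiples of \<open>u\<close>, but not on the
      nonzero multiples of \<open>y\<close>.\<close>
  have "z s \<noteq> 0"
  proof
    assume z0: "z s = 0"
    then have eq: "complex_of_real s *\<^sub>C y = (- complex_of_real (1 - s)) *\<^sub>C u"
      unfolding z_def by (metis add.commute eq_neg_iff_add_eq_0 scaleC_minus_one scaleC_scaleC
          mult_minus1)
    have "cinner (B (complex_of_real s *\<^sub>C y)) (complex_of_real s *\<^sub>C y) = 0"
      unfolding eq by (simp add: scale cinner_scaleC_left cinner_scaleC_right u)
    then have "s = 0"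
      by (simp add: scale cinner_scaleC_left cinner_scaleC_right y)
    with z0 u show False
      by (simp add: z_def scaleC_one scaleC_zero_left)
  qed
  then have n: "norm (z s) > 0"
    by simp
  define v where "v = complex_of_real (1 / norm (z s)) *\<^sub>C z s"
  have "norm v = 1"
    using n by (simp add: v_def norm_scaleC norm_divide)
  moreover have "cinner (B v) v = complex_of_real (t * (norm (z s))\<^sup>2 / (norm (z s))\<^sup>2)"
    using s(3) unfolding v_def scale cinner_scaleC_left cinner_scaleC_right q
    by (simp add: h_def power2_eq_square)
  ultimately show ?thesis
    using n by auto
qed

text \<open>An affine change \<open>A \<mapsto> (A - a) / (b - a)\<close> of the operator acts on the numerical range
  as the same affine map, and sends two given distinct values to \<open>0\<close> and \<open>1\<close>.\<close>

lemma convex_numerical_range: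
  fixes A :: "'a::complex_inner \<Rightarrow> 'a"
  assumes "bounded_clinear A"
  shows "convex (numerical_range A)"
  unfolding convex_alt
proof (intro ballI allI impI)
  fix a b t
  assume "a \<in> numerical_range A" "b \<in> numerical_range A" and t: "0 \<le> t \<and> t \<le> (1::real)"
  then obtain x y where x: "norm x = 1" "cinner (A x) x = a" and y: "norm y = 1" "cinner (A y) y = b"
    by (auto simp: numerical_range_def)
  have A: "A (x + y) = A x + A y" "A (c *\<^sub>C x) = c *\<^sub>C A x" for c x y
    using assms by (auto simp: bounded_clinear_def linear_simps)
  show "(1 - t) *\<^sub>R a + t *\<^sub>R b \<in> numerical_range A"
  proof (cases "a = b")
    case True
    then have "(1 - t) *\<^sub>R a + t *\<^sub>R b = a"
      by (simp add: algebra_simps)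
    then show ?thesis
      using \<open>a \<in> numerical_range A\<close> by simp
  next
    case False
    define B where "B v = (1 / (b - a)) *\<^sub>C (A v - a *\<^sub>C v)" for v
    have B: "cinner (B v) v = (cinner (A v) v - a) / (b - a)" if "norm v = 1" for v
      using that by (simp add: B_def cinner_scaleC_left cinner_diff_left cinner_self_eq_norm)
    have "\<exists>z. norm z = 1 \<and> cinner (B z) z = complex_of_real t"
    proof (rule toeplitz_hausdorff_normalized[of B x y])
      show "B (v + v') = B v + B v'" for v v'
        by (simp add: B_def A scaleC_add_right scaleC_diff_right)
      show "B (c *\<^sub>C v) = c *\<^sub>C B v" for c v
        by (simp add: B_def A scaleC_diff_right scaleC_scaleC mult.commute mult.left_commute)
    qed (use x y t False B in auto)
    then obtain z where z: "norm z = 1" "cinner (B z) z = complex_of_real t"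
      by blast
    then have "cinner (A z) z = a + complex_of_real t * (b - a)"
      using B[of z] False by (simp add: field_simps)
    then have "cinner (A z) z = (1 - t) *\<^sub>R a + t *\<^sub>R b"
      by (simp add: scaleR_conv_of_real algebra_simps)
    with z(1) show ?thesis
      unfolding numerical_range_def by (smt (verit, best) mem_Collect_eq)
  qed
qed

section \<open>Half planes\<close>

lemma half_plane_eq: "half_plane \<theta> \<omega> = {z. inner (cis \<theta>) z > \<omega>}"
proof -
  have Re: "Re (cnj (cis \<theta>) * z) = inner (cis \<theta>) z" for z
    by (simp add: inner_complex_def)
  have one: "cnj (cis \<theta>) * cis \<theta> = 1"
    by (simp add: cis_cnj cis_mult)
  show ?thesis
  proof (intro set_eqI iffI)
    fix z assume "z \<in> half_plane \<theta> \<omega>"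
    then obtain l where l: "z = cis \<theta> * l" "Re l > \<omega>"
      by (auto simp: half_plane_def cis_conv_exp)
    have "cnj (cis \<theta>) * z = l"
      unfolding l(1) mult.assoc[symmetric] one by simp
    with l show "z \<in> {z. inner (cis \<theta>) z > \<omega>}"
      by (simp only: mem_Collect_eq Re[symmetric])
  next
    fix z assume "z \<in> {z. inner (cis \<theta>) z > \<omega>}"
    moreover have "z = cis \<theta> * (cnj (cis \<theta>) * z)"
      using one by (metis mult.assoc mult.commute mult_1)
    ultimately show "z \<in> half_plane \<theta> \<omega>"
      unfolding half_plane_def cis_conv_exp[symmetric] mem_Collect_eq Re[symmetric] by blast
  qed
qed

lemma open_half_plane: "open (half_plane \<theta> \<omega>)"
  by (simp add: half_plane_eq open_halfspace_gt)

lemma infdist_frontier_half_plane: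
  assumes "l \<in> half_plane \<theta> \<omega>"
  shows "infdist l (frontier (half_plane \<theta> \<omega>)) = inner (cis \<theta>) l - \<omega>"
proof -
  define m where "m = l - (inner (cis \<theta>) l - \<omega>) *\<^sub>R cis \<theta>"
  have unit: "inner (cis \<theta>) (cis \<theta>) = 1"
    by (simp add: power2_norm_eq_inner[symmetric])
  have fr: "frontier (half_plane \<theta> \<omega>) = {z. inner (cis \<theta>) z = \<omega>}"
    by (simp add: half_plane_eq frontier_halfspace_gt)
  have pos: "inner (cis \<theta>) l - \<omega> > 0"
    using assms by (simp add: half_plane_eq)
  have m: "m \<in> frontier (half_plane \<theta> \<omega>)"
    by (simp add: fr m_def inner_diff_right unit)
  show ?thesis
  proof (rule antisym)
    show "infdist l (frontier (half_plane \<theta> \<omega>)) \<le> inner (cis \<theta>) l - \<omega>"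
      using infdist_le[OF m, of l] pos by (simp add: m_def dist_norm)
    show "inner (cis \<theta>) l - \<omega> \<le> infdist l (frontier (half_plane \<theta> \<omega>))"
      unfolding infdist_def
    proof (subst if_not_P)
      show "frontier (half_plane \<theta> \<omega>) \<noteq> {}"
        using m by auto
      show "inner (cis \<theta>) l - \<omega> \<le> (INF a\<in>frontier (half_plane \<theta> \<omega>). dist l a)"
      proof (rule cINF_greatest)
        fix a assume "a \<in> frontier (half_plane \<theta> \<omega>)"
        then have "inner (cis \<theta>) l - \<omega> = inner (cis \<theta>) (l - a)"
          by (simp add: fr inner_diff_right)
        also have "\<dots> \<le> dist l a"
          using norm_cauchy_schwarz[of "cis \<theta>" "l - a"] by (simp add: dist_norm)
        finally show "inner (cis \<theta>) l - \<omega> \<le> dist l a" .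
      qed (use m in auto)
    qed
  qed
qed

section \<open>Coercive operators are invertible\<close>

text \<open>The Lax-Milgram theorem: a solution of \<open>B x = y\<close> is a fixed point of
  \<open>x \<mapsto> x - s (B x - y)\<close>, and coercivity makes this map a contraction for small \<open>s > 0\<close>.\<close>

lemma coercive_surj:
  fixes B :: "'a::complex_hilbert_space \<Rightarrow> 'a"
  assumes B: "bounded_linear B" and d: "d > 0"
    and coercive: "\<And>x. d * (norm x)\<^sup>2 \<le> Re (cinner (B x) x)"
  shows "surj B"
proof -
  obtain K where K: "\<And>x. norm (B x) \<le> norm x * K"
    using bounded_linear.bounded[OF B] by blast
  define M where "M = \<bar>K\<bar> + d"
  have M: "norm (B x) \<le> M * norm x" for x
  proof -
    have "norm x * K \<le> norm x * M"
      using d by (intro mult_left_mono) (auto simp: M_def)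
    with K[of x] show ?thesis
      by (simp add: mult.commute)
  qed
  have M0: "M > 0" "d \<le> M"
    using d by (auto simp: M_def)
  \<comment> \<open>This \<open>s\<close> minimises the bound \<open>1 - 2 s d + s\<^sup>2 M\<^sup>2\<close> of the squared contraction factor,
      and \<open>q\<close> is the minimum.\<close>
  define s where "s = d / M\<^sup>2"
  have s0: "s > 0"
    using d M0 by (simp add: s_def)
  define q where "q = 1 - d\<^sup>2 / M\<^sup>2"
  have q: "0 \<le> q" "q < 1"
    using d M0 power_mono[of d M 2] by (auto simp: q_def)
  have contr: "norm (x - s *\<^sub>R B x) \<le> sqrt q * norm x" for x
  proof -
    have "(norm (x - s *\<^sub>R B x))\<^sup>2
        = (norm x)\<^sup>2 - 2 * (s * Re (cinner (B x) x)) + s\<^sup>2 * (norm (B x))\<^sup>2"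
    proof -
      have "Re (cinner x (s *\<^sub>R B x)) = s * Re (cinner (B x) x)"
        using cinner_commute[of x "B x"]
        by (simp add: scaleC_of_real[symmetric] cinner_scaleC_right)
      then show ?thesis
        by (simp add: norm_diff_square power_mult_distrib)
    qed
    also have "\<dots> \<le> (norm x)\<^sup>2 - 2 * (s * (d * (norm x)\<^sup>2)) + s\<^sup>2 * (M * norm x)\<^sup>2"
    proof -
      have "s * (d * (norm x)\<^sup>2) \<le> s * Re (cinner (B x) x)"
        using s0 coercive by (intro mult_left_mono) auto
      moreover have "s\<^sup>2 * (norm (B x))\<^sup>2 \<le> s\<^sup>2 * (M * norm x)\<^sup>2"
        using M by (intro mult_left_mono power_mono) auto
      ultimately show ?thesis
        by linarith
    qed
    also have "\<dots> = q * (norm x)\<^sup>2"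
      using M0 by (simp add: s_def q_def field_simps power2_eq_square)
    also have "\<dots> = (sqrt q * norm x)\<^sup>2"
      using q by (simp add: power_mult_distrib)
    finally show ?thesis
      by (rule power2_le_imp_le) (use q in simp)
  qed
  have "\<exists>x. B x = y" for y
  proof -
    define f where "f x = x - s *\<^sub>R (B x - y)" for x
    have "\<exists>!x. f x = x"
    proof (rule banach_fix_type[of "sqrt q"])
      show "\<forall>x y. dist (f x) (f y) \<le> sqrt q * dist x y"
      proof (intro allI)
        fix x x' :: 'a
        have "f x - f x' = (x - x') - s *\<^sub>R B (x - x')"
          using B by (simp add: f_def linear_simps algebra_simps)
        then show "dist (f x) (f x') \<le> sqrt q * dist x x'"
          using contr[of "x - x'"] by (simp add: dist_norm)
      qed
    qed (use q in auto)
    then obtain x where "f x = x"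
      by blast
    with s0 show ?thesis
      by (auto simp: f_def)
  qed
  then show ?thesis
    by (metis surjI)
qed

text \<open>Coercivity bounds \<open>l - A\<close> from below by \<open>d\<close>, which gives injectivity and the norm of the
  inverse; a rotation by the phase \<open>c\<close> affects neither this bound nor surjectivity.\<close>

lemma resolvent_coercive:
  fixes A :: "'a::complex_hilbert_space \<Rightarrow> 'a"
  assumes A: "bounded_clinear A" and d: "d > 0" and c: "cmod c = 1"
    and coercive: "\<And>x. d * (norm x)\<^sup>2 \<le> Re (c * cinner (l *\<^sub>C x - A x) x)"
  shows "l \<in> resolvent_set UNIV A" and "onorm (resolvent UNIV A l) \<le> 1 / d"
proof -
  define T where "T x = l *\<^sub>C x - A x" for x
  define R where "R = resolvent UNIV A l"
  have A': "bounded_linear A" "\<And>k x. A (k *\<^sub>C x) = k *\<^sub>C A x"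
    using A by (auto simp: bounded_clinear_def)
  have bl_scale: "bounded_linear (\<lambda>x::'a. k *\<^sub>C x)" for k
    by (rule bounded_linear_intro[where K = "cmod k"])
      (simp_all add: scaleC_add_right scaleC_scaleR norm_scaleC)
  have T_bl: "bounded_linear T"
    unfolding T_def by (intro bounded_linear_sub bl_scale A')
  have T_scale: "T (k *\<^sub>C x) = k *\<^sub>C T x" for k x
    by (simp add: T_def A' scaleC_diff_right scaleC_scaleC mult.commute)
  have below: "d * norm x \<le> norm (T x)" for x
  proof (cases "x = 0")
    case False
    have "d * (norm x)\<^sup>2 \<le> Re (cinner (c *\<^sub>C T x) x)"
      using coercive by (simp add: T_def cinner_scaleC_left)
    also have "\<dots> \<le> norm (T x) * norm x"
      using Re_cinner_le_norm[of "c *\<^sub>C T x" x] by (simp add: norm_scaleC c)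
    finally show ?thesis
      using False by (simp add: power2_eq_square)
  qed simp
  have inj: "inj T"
  proof (rule injI)
    fix x y assume "T x = T y"
    then have "T (x - y) = 0"
      using T_bl by (simp add: linear_simps)
    with below[of "x - y"] d show "x = y"
      by (simp add: mult_le_0_iff)
  qed
  have "surj (\<lambda>x. c *\<^sub>C T x)"
  proof (rule coercive_surj[OF _ d])
    show "bounded_linear (\<lambda>x. c *\<^sub>C T x)"
      using bounded_linear_compose[OF bl_scale T_bl] .
    show "d * (norm x)\<^sup>2 \<le> Re (cinner (c *\<^sub>C T x) x)" for x
      using coercive by (simp add: T_def cinner_scaleC_left)
  qed
  then have surj: "surj T"
  proof -
    have "\<exists>x. T x = y" for y
    proof -
      obtain x where x: "c *\<^sub>C y = c *\<^sub>C T x"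
        using \<open>surj (\<lambda>x. c *\<^sub>C T x)\<close> by (metis surjD)
      have "inverse c * c = 1"
        using c by (metis left_inverse norm_zero zero_neq_one)
      then have "y = T x"
        using arg_cong[OF x, of "\<lambda>v. inverse c *\<^sub>C v"] by (simp add: scaleC_scaleC scaleC_one)
      then show ?thesis
        by blast
    qed
    then show ?thesis
      by (metis surjI)
  qed
  have R: "R = inv T"
    by (simp add: R_def resolvent_def T_def[abs_def])
  have TR: "T (R y) = y" for y
    by (simp add: R surj surj_f_inv_f)
  have R_eq: "R y = x" if "T x = y" for x y
    using that inj by (auto simp: R)
  have R_bound: "norm (R y) \<le> 1 / d * norm y" for y
    using below[of "R y"] d by (simp add: TR field_simps)
  have "bounded_linear R"
  proof (rule bounded_linear_intro)
    show "R (x + y) = R x + R y" for x y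
      by (rule R_eq) (use T_bl in \<open>simp add: linear_simps TR\<close>)
    show "R (r *\<^sub>R x) = r *\<^sub>R R x" for r x
      by (rule R_eq) (use T_bl in \<open>simp add: linear_simps TR\<close>)
    show "norm (R x) \<le> norm x * (1 / d)" for x
      using R_bound[of x] by (simp add: mult.commute)
  qed
  moreover have "R (k *\<^sub>C x) = k *\<^sub>C R x" for k x
    by (rule R_eq) (simp add: T_scale TR)
  moreover have "bij T"
    using inj surj by (simp add: bij_def)
  ultimately show "l \<in> resolvent_set UNIV A"
    unfolding resolvent_set_def mem_Collect_eq R_def[symmetric] bounded_clinear_def T_def by blast
  show "onorm (resolvent UNIV A l) \<le> 1 / d"
    unfolding R_def[symmetric] using R_bound d by (intro onorm_bound) auto
qed

section \<open>Half planes and the numerical range\<close>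

text \<open>In the squared resolvent estimate the terms \<open>t\<^sup>2\<close> on both sides cancel, leaving an upper
  bound, uniform in \<open>t\<close>, for a multiple of \<open>t\<close>. This is where the constant \<open>1\<close> in
  the estimate matters.\<close>

lemma numerical_range_disjoint_half_plane:
  fixes A :: "'a::complex_inner \<Rightarrow> 'a"
  assumes sub: "half_plane \<theta> \<omega> \<subseteq> resolvent_set UNIV A"
    and bound: "\<forall>l\<in>half_plane \<theta> \<omega>.
      onorm (resolvent UNIV A l) \<le> 1 / infdist l (frontier (half_plane \<theta> \<omega>))"
  shows "half_plane \<theta> \<omega> \<inter> numerical_range A = {}"
proof -
  have "inner (cis \<theta>) (cinner (A x) x) \<le> \<omega>" if x: "norm x = 1" for x
  proof (rule ccontr)
    assume "\<not> ?thesis"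
    then have e: "inner (cis \<theta>) (cinner (A x) x) - \<omega> > 0" (is "?e > 0")
      by simp
    define v where "v = A x - (complex_of_real \<omega> * cis \<theta>) *\<^sub>C x"
    have unit: "cnj (cis \<theta>) * cis \<theta> = 1" "inner (cis \<theta>) (cis \<theta>) = 1"
      by (simp_all add: cis_cnj cis_mult power2_norm_eq_inner[symmetric])
    have v: "Re (cnj (cis \<theta>) * cinner v x) = ?e"
    proof -
      have "cnj (cis \<theta>) * cinner v x
          = cnj (cis \<theta>) * cinner (A x) x - complex_of_real \<omega> * (cnj (cis \<theta>) * cis \<theta>)"
        using x by (simp add: v_def cinner_diff_left cinner_scaleC_left cinner_self_eq_norm
            algebra_simps)
      then show ?thesis
        unfolding unit by (simp add: inner_complex_def)
    qed
    have key: "2 * t * ?e \<le> (norm v)\<^sup>2" if t: "t > 0" for t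
    proof -
      define l where "l = complex_of_real (\<omega> + t) * cis \<theta>"
      have l_inner: "inner (cis \<theta>) l = \<omega> + t"
        using unit(2) by (simp only: l_def scaleR_conv_of_real[symmetric] inner_scaleR_right)
          simp
      then have l: "l \<in> half_plane \<theta> \<omega>"
        using t by (simp add: half_plane_eq)
      have dist: "infdist l (frontier (half_plane \<theta> \<omega>)) = t"
        using infdist_frontier_half_plane[OF l] l_inner by simp
      define R where "R = resolvent UNIV A l"
      have bij: "bij (\<lambda>x. l *\<^sub>C x - A x)" and "bounded_clinear R"
        using sub l by (auto simp: resolvent_set_def R_def)
      then have Rbl: "bounded_linear R"
        by (simp add: bounded_clinear_def)
      have "R (l *\<^sub>C x - A x) = x"
        using inv_f_f[OF bij_is_inj[OF bij], of x] by (simp add: R_def resolvent_def)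
      then have "norm x \<le> onorm R * norm (l *\<^sub>C x - A x)"
        using onorm[OF Rbl, of "l *\<^sub>C x - A x"] by simp
      also have "\<dots> \<le> 1 / t * norm (l *\<^sub>C x - A x)"
        using bound l dist by (intro mult_right_mono) (auto simp: R_def)
      finally have "t \<le> norm (l *\<^sub>C x - A x)"
        using t x by (simp add: field_simps)
      also have "l *\<^sub>C x - A x = - (v - (complex_of_real t * cis \<theta>) *\<^sub>C x)"
        by (simp add: l_def v_def scaleC_add_left[symmetric] algebra_simps)
      finally have "t\<^sup>2 \<le> (norm (v - (complex_of_real t * cis \<theta>) *\<^sub>C x))\<^sup>2"
        using t by (intro power_mono) (auto simp: norm_minus_commute)
      also have "\<dots> = (norm v)\<^sup>2 - 2 * Re (complex_of_real t * (cnj (cis \<theta>) * cinner v x)) + t\<^sup>2"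
        using x t by (simp add: norm_diff_square cinner_scaleC_right norm_scaleC norm_mult
            mult.assoc)
      also have "Re (complex_of_real t * (cnj (cis \<theta>) * cinner v x)) = t * ?e"
        using v by simp
      finally show ?thesis
        by simp
    qed
    \<comment> \<open>Large enough to violate the bound just obtained.\<close>
    define t where "t = ((norm v)\<^sup>2 + 1) / ?e"
    have "t > 0"
      using e by (simp add: t_def add_nonneg_pos)
    moreover have "t * ?e = (norm v)\<^sup>2 + 1"
      using e by (simp add: t_def)
    ultimately have "2 * ((norm v)\<^sup>2 + 1) \<le> (norm v)\<^sup>2"
      using key[of t] by (simp add: mult.assoc)
    moreover have "0 \<le> (norm v)\<^sup>2"
      by simp
    ultimately show False
      by argo
  qed
  then show ?thesis
    by (fastforce simp: half_plane_eq numerical_range_def)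
qed

text \<open>Homogeneity turns the bound on the numerical range into one for the quadratic form at all
  vectors, so that \<open>l - A\<close>, rotated by \<open>cnj (cis \<theta>)\<close>, is coercive with the distance of
  \<open>l\<close> from the boundary as its constant.\<close>

lemma half_plane_subset_numerical_resolvent_set:
  fixes A :: "'a::complex_hilbert_space \<Rightarrow> 'a"
  assumes A: "bounded_clinear A" and \<theta>: "\<theta> \<in> {0..<2 * pi}"
    and disj: "half_plane \<theta> \<omega> \<inter> numerical_range A = {}"
  shows "half_plane \<theta> \<omega> \<subseteq> numerical_resolvent_set UNIV A"
proof -
  have scale: "A (k *\<^sub>C x) = k *\<^sub>C A x" for k x
    using A by (simp add: bounded_clinear_def)
  have form: "inner (cis \<theta>) (cinner (A x) x) \<le> \<omega> * (norm x)\<^sup>2" for x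
  proof (cases "x = 0")
    case True
    have "A 0 = 0"
      using A by (simp add: bounded_clinear_def linear_simps)
    with True show ?thesis
      by (simp add: cinner_zero_left)
  next
    case False
    define k where "k = 1 / norm x"
    define u where "u = complex_of_real k *\<^sub>C x"
    have "norm u = 1"
      using False by (simp add: u_def k_def norm_scaleC norm_divide)
    then have "cinner (A u) u \<in> numerical_range A"
      unfolding numerical_range_def by blast
    then have "inner (cis \<theta>) (cinner (A u) u) \<le> \<omega>"
      using disj unfolding half_plane_eq by (metis disjoint_iff mem_Collect_eq not_less)
    moreover have "cinner (A u) u = k\<^sup>2 *\<^sub>R cinner (A x) x"
      by (simp add: u_def scale cinner_scaleC_left cinner_scaleC_right scaleR_conv_of_real
          power2_eq_square)
    ultimately show ?thesis
      using False by (simp add: k_def field_simps)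
  qed
  have coercive: "(inner (cis \<theta>) l - \<omega>) * (norm x)\<^sup>2
      \<le> Re (cnj (cis \<theta>) * cinner (l *\<^sub>C x - A x) x)" for l x
  proof -
    have "Re (cnj (cis \<theta>) * cinner (l *\<^sub>C x - A x) x)
        = inner (cis \<theta>) l * (norm x)\<^sup>2 - inner (cis \<theta>) (cinner (A x) x)"
      by (simp add: inner_complex_def cinner_diff_left cinner_scaleC_left cinner_self_eq_norm
          algebra_simps)
    with form[of x] show ?thesis
      by (simp add: algebra_simps)
  qed
  have "l \<in> resolvent_set UNIV A \<and>
      onorm (resolvent UNIV A l) \<le> 1 / infdist l (frontier (half_plane \<theta> \<omega>))"
    if l: "l \<in> half_plane \<theta> \<omega>" for l
  proof -
    have "inner (cis \<theta>) l - \<omega> > 0" "cmod (cnj (cis \<theta>)) = 1"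
      using l by (simp_all add: half_plane_eq)
    from resolvent_coercive[OF A this coercive] show ?thesis
      by (simp add: infdist_frontier_half_plane[OF l])
  qed
  then show ?thesis
    using \<theta> unfolding numerical_resolvent_set_def by blast
qed

text \<open>The hyperplane separation theorem, with the normal vector in polar form. The empty set,
  which is the numerical range on the zero space, is treated apart because the separation theorem
  may then return a zero normal vector.\<close>

lemma half_plane_separates:
  assumes "convex S" "closed S" "z \<notin> S"
  obtains \<theta> \<omega> where "\<theta> \<in> {0..<2 * pi}" "z \<in> half_plane \<theta> \<omega>" "half_plane \<theta> \<omega> \<inter> S = {}"
proof (cases "S = {}")
  case True
  show ?thesis
    by (rule that[of 0 "Re z - 1"]) (simp_all add: True half_plane_eq inner_complex_def)
next
  case False
  obtain a b where ab: "inner a z < b" "\<And>x. x \<in> S \<Longrightarrow> inner a x > b"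
    using separating_hyperplane_closed_point[OF assms] by blast
  have n: "norm a > 0"
    using ab False by fastforce
  define \<theta> where "\<theta> = Arg2pi (- a)"
  have "- a = norm a *\<^sub>R cis \<theta>"
    using Arg2pi_eq[of "- a"] by (simp add: \<theta>_def cis_conv_exp scaleR_conv_of_real)
  then have a: "inner a x = - (norm a * inner (cis \<theta>) x)" for x
    by (metis inner_minus_left inner_scaleR_left minus_minus)
  show ?thesis
  proof (rule that[of \<theta> "- b / norm a"])
    show "\<theta> \<in> {0..<2 * pi}"
      by (simp add: \<theta>_def Arg2pi_ge_0 Arg2pi_lt_2pi)
    show "z \<in> half_plane \<theta> (- b / norm a)"
      using ab(1) n by (simp add: half_plane_eq a field_simps)
    show "half_plane \<theta> (- b / norm a) \<inter> S = {}"
      using ab(2) n by (fastforce simp: half_plane_eq a field_simps)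
  qed
qed

theorem corollary2p8:
  fixes A :: "'h::complex_hilbert_space \<Rightarrow> 'h"
  assumes "bounded_clinear A"
  shows "numerical_spectrum UNIV A = closure (numerical_range A)"
proof -
  have "numerical_resolvent_set UNIV A \<subseteq> - closure (numerical_range A)"
  proof
    fix l assume "l \<in> numerical_resolvent_set UNIV A"
    then obtain \<theta> \<omega> where l: "l \<in> half_plane \<theta> \<omega>"
      and "half_plane \<theta> \<omega> \<inter> numerical_range A = {}"
      using numerical_range_disjoint_half_plane unfolding numerical_resolvent_set_def by blast
    then have "half_plane \<theta> \<omega> \<inter> closure (numerical_range A) = {}"
      by (simp add: open_half_plane open_Int_closure_eq_empty)
    with l show "l \<in> - closure (numerical_range A)"
      by blast
  qed
  moreover have "- closure (numerical_range A) \<subseteq> numerical_resolvent_set UNIV A"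
  proof
    fix l assume "l \<in> - closure (numerical_range A)"
    then obtain \<theta> \<omega> where "\<theta> \<in> {0..<2 * pi}" "l \<in> half_plane \<theta> \<omega>"
      "half_plane \<theta> \<omega> \<inter> closure (numerical_range A) = {}"
      using half_plane_separates[of "closure (numerical_range A)" l]
        convex_closure[OF convex_numerical_range[OF assms]] by auto
    moreover from this have "half_plane \<theta> \<omega> \<inter> numerical_range A = {}"
      using closure_subset by blast
    ultimately show "l \<in> numerical_resolvent_set UNIV A"
      using half_plane_subset_numerical_resolvent_set[OF assms] by blast
  qed
  ultimately show ?thesis
    unfolding numerical_spectrum_def by blast
qed

end
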